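(* Let $p\ge 5$ be a prime and let $A=(a_{m,n})_{1\le m,n\le p}$ be the $p\times p$ matrix with $$a_{m,n}=\begin{cases} -x & \text{if } m+n\equiv 0 \pmod p,\\ \exp\left\{2\pi i (m+n)^p/p^2\right\} & \text{otherwise.}\end{cases}$$ Then $$\det(A)=(-1)^{(p+1)/2}L(p,x).$$
   Context: For a prime $p\ge 5$ and $g$ a primitive root modulo $p^2$, define $$\eta_n=\sum_{j=0}^{p-2}\exp\left\{2\pi i\, g^{pj}(g^p+pn)/p^2\right\},\qquad L(p,x)=\prod_{n=1}^{p}(x-\eta_n).$$ Matrix indices are interpreted in $\mathbb{Z}/p\mathbb{Z}$ with representatives $\{1,2,\dots,p\}$. *)

theory Defs
  imports
    Complex_Main
    "HOL-Number_Theory.Residue_Primitive_Roots"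
    "Jordan_Normal_Form.Determinant"
begin

definition eta :: "nat \<Rightarrow> nat \<Rightarrow> nat \<Rightarrow> complex" where
  "eta p g n =
     (\<Sum>j = 0..p - 2.
        exp (2 * of_real pi * \<i> * of_nat (g ^ (p * j) * (g ^ p + p * n)) / of_nat (p\<^sup>2)))"

definition L :: "nat \<Rightarrow> nat \<Rightarrow> complex \<Rightarrow> complex" where
  "L p g x = (\<Prod>n = 1..p. (x - eta p g n))"

definition entry :: "nat \<Rightarrow> complex \<Rightarrow> nat \<Rightarrow> nat \<Rightarrow> complex" where
  "entry p x m n =
     (if [m + n = 0] (mod p) then - x
      else exp (2 * of_real pi * \<i> * of_nat ((m + n) ^ p) / of_nat (p\<^sup>2)))"

text \<open>Matrices in this library are indexed from 0, so position \<open>(i, j)\<close> holds the entry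
  with one-based indices \<open>m = i + 1\<close> and \<open>n = j + 1\<close>. This shift matters, since the entries
  depend on \<open>m + n\<close>.\<close>
definition A :: "nat \<Rightarrow> complex \<Rightarrow> complex mat" where
  "A p x = mat p p (\<lambda>(i, j). entry p x (i + 1) (j + 1))"

end

theory Submission
  imports Defs
begin

text \<open>
  The \<open>p\<close>-th power residues modulo \<open>p\<^sup>2\<close> depend only on the base modulo \<open>p\<close>, so \<open>A\<close> is the
  Hankel matrix \<open>F (m + n)\<close> of a function \<open>F\<close> on \<open>\<int>/p\<close>. Multiplying it by the Fourier matrix
  yields the Fourier matrix with rows permuted by \<open>m \<mapsto> - m\<close> and columns scaled by the Fourier
  coefficients of \<open>F\<close>. That permutation is a product of \<open>(p - 1) / 2\<close> transpositions. Writing the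
  nonzero residues as \<open>b = g\<^sup>j\<^sup>+\<^sup>1\<close> turns \<open>\<eta>\<^sub>n\<close> into the coefficient of \<open>F\<close> at frequency \<open>n / g\<close>,
  up to the term \<open>- x\<close> at \<open>b = 0\<close>; the sign of \<open>\<Prod>n. (\<eta>\<^sub>n - x)\<close> gives one further \<open>- 1\<close>.
\<close>

section \<open>Additive characters modulo \<open>n\<close>\<close>

definition unity_root :: "nat \<Rightarrow> int \<Rightarrow> complex" where
  "unity_root n t = cis (2 * pi * of_int t / of_nat n)"

lemma unity_root_exp:
  "unity_root n (int t) = exp (2 * of_real pi * \<i> * of_nat t / of_nat n)"
  by (simp add: unity_root_def cis_conv_exp mult_ac)

lemma unity_root_0 [simp]: "unity_root n 0 = 1"
  by (simp add: unity_root_def)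

lemma unity_root_add: "unity_root n (s + t) = unity_root n s * unity_root n t"
  by (simp add: unity_root_def cis_mult ring_distribs add_divide_distrib)

lemma unity_root_power: "unity_root n t ^ k = unity_root n (int k * t)"
  by (simp add: unity_root_def DeMoivre mult_ac)

lemma unity_root_eq_1_iff:
  assumes "n > 0"
  shows "unity_root n t = 1 \<longleftrightarrow> int n dvd t"
proof
  assume "int n dvd t"
  then obtain k where "t = int n * k" by (elim dvdE)
  then have "2 * pi * of_int t / of_nat n = 2 * pi * real_of_int k"
    using assms by (simp add: field_simps)
  then show "unity_root n t = 1"
    by (simp add: unity_root_def)
next
  assume "unity_root n t = 1"
  then have "cos (2 * pi * of_int t / of_nat n) = 1"
    by (simp add: unity_root_def complex_eq_iff)
  then obtain k :: int where "2 * pi * of_int t / of_nat n = of_int k * 2 * pi"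
    by (subst (asm) cos_one_2pi_int) blast
  then have "real_of_int t = real_of_int (k * int n)"
    using assms by (simp add: field_simps)
  then have "t = k * int n"
    by (subst (asm) of_int_eq_iff)
  then show "int n dvd t" by simp
qed

lemma unity_root_cong:
  assumes "n > 0" and "[s = t] (mod int n)"
  shows "unity_root n s = unity_root n t"
proof -
  have "unity_root n (s - t) = 1"
    using assms by (simp add: unity_root_eq_1_iff cong_iff_dvd_diff)
  then show ?thesis
    using unity_root_add[of n "s - t" t] by simp
qed

lemma unity_root_square_mult:
  assumes "n > 0"
  shows "unity_root (n\<^sup>2) (int n * t) = unity_root n t"
  using assms by (simp add: unity_root_def power2_eq_square mult.assoc)

text \<open>A geometric series whose ratio is an \<open>n\<close>-th root of unity other than 1. The
  shift \<open>int k + 1\<close> matches one-based matrix indices and only contributes a constant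
  factor.\<close>

lemma sum_unity_root:
  assumes "n > 0" and "\<not> int n dvd t"
  shows "(\<Sum>k<n. unity_root n (t * (int k + 1))) = 0"
proof -
  have "(\<Sum>k<n. unity_root n (t * (int k + 1))) = (\<Sum>k<n. unity_root n t * unity_root n t ^ k)"
    by (intro sum.cong refl) (simp add: unity_root_power ring_distribs unity_root_add mult_ac)
  also have "\<dots> = unity_root n t * (\<Sum>k<n. unity_root n t ^ k)"
    by (simp add: sum_distrib_left)
  also have "(\<Sum>k<n. unity_root n t ^ k) = (unity_root n t ^ n - 1) / (unity_root n t - 1)"
    using assms by (intro geometric_sum) (simp add: unity_root_eq_1_iff)
  also have "unity_root n t ^ n = 1"
    using assms by (simp add: unity_root_power unity_root_eq_1_iff)
  finally show ?thesis by simp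
qed

lemma sum_periodic_shift:
  fixes H :: "int \<Rightarrow> 'a::comm_monoid_add"
  assumes "n > 0" and "\<And>s t. [s = t] (mod int n) \<Longrightarrow> H s = H t"
  shows "(\<Sum>j<n. H (int j + c)) = (\<Sum>b<n. H (int b))"
proof (rule sum.reindex_bij_witness[where i = "\<lambda>b. nat ((int b - c) mod int n)"
      and j = "\<lambda>j. nat ((int j + c) mod int n)"])
  show "H (int (nat ((int j + c) mod int n))) = H (int j + c)" if "j \<in> {..<n}" for j
    using assms by (intro assms(2)) (simp add: cong_def)
qed (use assms(1) in \<open>auto simp: mod_simps nat_less_iff\<close>)

section \<open>Determinants of Fourier and Hankel matrices\<close>

text \<open>Here \<open>r a k\<close> reverses the interval of length \<open>2 * k\<close> that
  starts at \<open>a\<close>. Each induction step peels off the swap of the two endpoints; the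
  interior starts at \<open>Suc a\<close>, so \<open>a\<close> has to vary.\<close>

lemma sign_reversal:
  fixes a k :: nat
  defines "r \<equiv> \<lambda>a k i. if a \<le> i \<and> i < a + 2 * k then 2 * a + 2 * k - Suc i else i"
  shows "r a k permutes {a..<a + 2 * k} \<and> sign (r a k) = (- 1) ^ k"
proof (induction k arbitrary: a)
  case 0
  have "r a 0 = id" by (auto simp: r_def fun_eq_iff)
  then show ?case by (simp add: permutes_id del: id_apply)
next
  case (Suc k)
  have eq: "r a (Suc k) = transpose a (a + 2 * k + 1) \<circ> r (Suc a) k"
    by (auto simp: r_def fun_eq_iff transpose_def)
  have IH: "r (Suc a) k permutes {Suc a..<Suc a + 2 * k}" "sign (r (Suc a) k) = (- 1) ^ k"
    using Suc.IH[of "Suc a"] by blast+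
  have "r (Suc a) k permutes {a..<a + 2 * Suc k}"
    using IH(1) by (rule permutes_subset) auto
  moreover have "transpose a (a + 2 * k + 1) permutes {a..<a + 2 * Suc k}"
    by (rule permutes_swap_id) auto
  ultimately have "r a (Suc k) permutes {a..<a + 2 * Suc k}"
    unfolding eq by (rule permutes_compose)
  moreover have "permutation (r (Suc a) k)"
    using IH(1) by (auto simp: permutation_permutes)
  then have "sign (r a (Suc k)) = (- 1) ^ Suc k"
    unfolding eq using IH(2) by (simp add: sign_compose permutation_swap_id sign_swap_id)
  ultimately show ?case by blast
qed

text \<open>Orthogonality of characters: the product with the entrywise conjugate \<open>V\<close>
  is \<open>n\<close> times the identity. Coprimality of \<open>h\<close> keeps the frequencies of
  different indices distinct modulo \<open>n\<close>.\<close>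

lemma det_fourier_nonzero:
  fixes n :: nat and h :: int
  assumes "n > 0" and "coprime h (int n)"
  shows "det (mat n n (\<lambda>(i, j). unity_root n (h * (int j + 1) * (int i + 1)))) \<noteq> 0"
    (is "det ?W \<noteq> 0")
proof -
  define V where "V = mat n n (\<lambda>(i, j). unity_root n (- (h * (int i + 1) * (int j + 1))))"
  have W: "?W \<in> carrier_mat n n" and V: "V \<in> carrier_mat n n"
    by (simp_all add: V_def)
  have "?W * V = of_nat n \<cdot>\<^sub>m 1\<^sub>m n"
  proof (rule eq_matI)
    fix i j
    assume "i < dim_row (complex_of_nat n \<cdot>\<^sub>m 1\<^sub>m n)" "j < dim_col (complex_of_nat n \<cdot>\<^sub>m 1\<^sub>m n)"
    then have ij: "i < n" "j < n" by auto
    have "(?W * V) $$ (i, j) = (\<Sum>k<n. unity_root n (h * (int k + 1) * (int i + 1))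
        * unity_root n (- (h * (int k + 1) * (int j + 1))))"
      using ij by (simp add: V_def scalar_prod_def atLeast0LessThan)
    also have "\<dots> = (\<Sum>k<n. unity_root n (h * (int i - int j) * (int k + 1)))"
      by (intro sum.cong refl) (simp flip: unity_root_add add: algebra_simps)
    also have "\<dots> = (if i = j then of_nat n else 0)"
    proof (cases "i = j")
      case False
      have "\<not> int n dvd h * (int i - int j)"
      proof
        assume "int n dvd h * (int i - int j)"
        then have "int n dvd int i - int j"
          using assms(2) by (simp add: coprime_dvd_mult_right_iff coprime_commute)
        then have "[int i = int j] (mod int n)"
          by (simp add: cong_iff_dvd_diff)
        with ij False show False
          by (simp add: cong_def)
      qed
      with False show ?thesis
        using sum_unity_root[OF assms(1)] by simp
    qed simp
    finally show "(?W * V) $$ (i, j) = (of_nat n \<cdot>\<^sub>m 1\<^sub>m n) $$ (i, j)"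
      using ij by simp
  qed (auto simp: V_def)
  then have "det ?W * det V = of_nat n ^ n"
    using det_mult[OF W V] by (simp add: det_smult)
  then show ?thesis
    using assms(1) by auto
qed

text \<open>Since \<open>F\<close> sees only the sum of the indices, shifting the summation variable
  pulls the row index out of each entry of \<open>?M * W\<close> as a character value. The
  multiplier \<open>h\<close> only reorders the Fourier coefficients; it lets the
  \<open>k\<close>-th factor be matched with \<open>eta p g k\<close> later.\<close>

lemma det_hankel_periodic:
  fixes n :: nat and h :: int and F :: "int \<Rightarrow> complex"
  assumes "odd n" and h: "coprime h (int n)"
    and periodic: "\<And>s t. [s = t] (mod int n) \<Longrightarrow> F s = F t"
  shows "det (mat n n (\<lambda>(i, j). F (int (i + 1) + int (j + 1)))) =
    (- 1) ^ ((n - 1) div 2) * (\<Prod>k = 1..n. \<Sum>b<n. F (int b) * unity_root n (h * int k * int b))"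
    (is "det ?M = _ * (\<Prod>k = 1..n. ?c k)")
proof -
  have n: "n > 0"
    using assms(1) by (auto elim: oddE)
  define W where "W = mat n n (\<lambda>(i, j). unity_root n (h * (int j + 1) * (int i + 1)))"
  \<comment> \<open>Zero-based form of negation: \<open>m = i + 1\<close> goes to
    \<open>n - m\<close>, which sits at position \<open>n - 2 - i\<close>. The last position stands
    for the residue 0 and stays fixed.\<close>
  define r where "r = (\<lambda>i. if i < n - 1 then n - 2 - i else i)"
  define P where "P = mat n n (\<lambda>(i, j). W $$ (r i, j))"
  define D where "D = mat n n (\<lambda>(i, j). if i = j then ?c (j + 1) else 0)"
  have carrier [simp]: "?M \<in> carrier_mat n n" "W \<in> carrier_mat n n" "P \<in> carrier_mat n n"
      "D \<in> carrier_mat n n"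
    by (simp_all add: W_def P_def D_def)
  \<comment> \<open>As \<open>n\<close> is odd, the nonzero residues occupy an interval of even
    length, which \<open>r\<close> reverses.\<close>
  have "2 * ((n - 1) div 2) = n - 1"
    using assms(1) by simp
  then have "r = (\<lambda>i. if 0 \<le> i \<and> i < 0 + 2 * ((n - 1) div 2)
      then 2 * 0 + 2 * ((n - 1) div 2) - Suc i else i)"
    by (auto simp: r_def fun_eq_iff)
  with sign_reversal[of 0 "(n - 1) div 2"] \<open>2 * ((n - 1) div 2) = n - 1\<close>
  have r: "r permutes {0..<n - 1}" "sign r = (- 1) ^ ((n - 1) div 2)"
    by auto
  have "r permutes {0..<n}"
    using r(1) by (rule permutes_subset) auto
  then have det_P: "det P = (- 1) ^ ((n - 1) div 2) * det W"
    unfolding P_def using r(2) by (simp add: det_permute_rows)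
  have det_D: "det D = (\<Prod>k = 1..n. ?c k)"
  proof -
    have "det D = prod_list (diag_mat D)"
      by (rule det_upper_triangular[of _ n]) (auto simp: D_def)
    also have "\<dots> = (\<Prod>j = 0..<n. D $$ (j, j))"
      by (simp add: prod_list_diag_prod D_def)
    also have "\<dots> = (\<Prod>j = 0..<n. ?c (j + 1))"
      by (intro prod.cong refl) (simp add: D_def)
    also have "\<dots> = (\<Prod>k = 1..n. ?c k)"
      using prod.shift_bounds_nat_ivl[of ?c 0 1 n] by (simp add: atLeastLessThanSuc_atLeastAtMost)
    finally show ?thesis .
  qed
  have "?M * W = P * D"
  proof (rule eq_matI)
    fix i k
    assume "i < dim_row (P * D)" "k < dim_col (P * D)"
    then have ik: "i < n" "k < n"
      by (simp_all add: P_def D_def)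
    define c where "c = h * (int k + 1)"
    \<comment> \<open>The summand of entry \<open>(i, k)\<close> in terms of
      \<open>t = i + j + 2\<close>; the column variable of \<open>?M\<close> is recovered as
      \<open>j + 1 = t - (i + 1)\<close>.\<close>
    define H where "H = (\<lambda>t. F t * unity_root n (c * (t - (int i + 1))))"
    have H: "H s = H t" if "[s = t] (mod int n)" for s t
      unfolding H_def using that n
      by (intro arg_cong2[where f = times] periodic unity_root_cong cong_mult cong_diff) auto
    have "[int (r i) + 1 = - (int i + 1)] (mod int n)"
    proof (cases "i < n - 1")
      \<comment> \<open>In the fixed last row both sides represent the residue 0, and they differ by
        \<open>2 * n\<close>.\<close>
      case False
      with ik have "int (r i) + 1 - - (int i + 1) = int n * 2"
        by (simp add: r_def)
      then show ?thesis
        by (simp only: cong_iff_dvd_diff dvd_triv_left)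
    qed (auto simp: r_def cong_iff_dvd_diff)
    then have "unity_root n (c * (int (r i) + 1)) = unity_root n (c * - (int i + 1))"
      by (intro unity_root_cong[OF n] cong_mult cong_refl)
    moreover have "r i < n"
      using ik by (simp add: r_def)
    ultimately have row: "unity_root n (- (c * (int i + 1))) = W $$ (r i, k)"
      using ik by (simp add: W_def c_def del: minus_add_distrib)
    have "(?M * W) $$ (i, k) = (\<Sum>j<n. H (int j + (int i + 2)))"
      using ik by (simp add: W_def scalar_prod_def atLeast0LessThan H_def c_def algebra_simps)
    also have "\<dots> = (\<Sum>b<n. H (int b))"
      by (rule sum_periodic_shift[OF n H])
    also have "\<dots> = (\<Sum>b<n. unity_root n (- (c * (int i + 1))) *
        (F (int b) * unity_root n (h * int (k + 1) * int b)))"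
    proof (intro sum.cong refl)
      fix b
      have "c * (int b - (int i + 1)) = - (c * (int i + 1)) + h * int (k + 1) * int b"
        by (simp add: c_def algebra_simps)
      then show "H (int b) = unity_root n (- (c * (int i + 1))) *
          (F (int b) * unity_root n (h * int (k + 1) * int b))"
        unfolding H_def by (simp only: unity_root_add mult_ac)
    qed
    also have "\<dots> = W $$ (r i, k) * ?c (k + 1)"
      by (simp only: row sum_distrib_left)
    also have "\<dots> = (P * D) $$ (i, k)"
      using ik by (simp add: P_def D_def scalar_prod_def if_distrib[of "times _"] cong: if_cong)
    finally show "(?M * W) $$ (i, k) = (P * D) $$ (i, k)" .
  qed (auto simp: P_def D_def W_def)
  then have "det ?M * det W = det P * det D"
    by (metis det_mult carrier)
  then have "det ?M * det W = (- 1) ^ ((n - 1) div 2) * (\<Prod>k = 1..n. ?c k) * det W"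
    by (simp add: det_P det_D mult_ac)
  moreover have "det W \<noteq> 0"
    unfolding W_def using n h by (rule det_fourier_nonzero)
  ultimately show ?thesis by simp
qed

section \<open>Powers modulo a square and primitive roots\<close>

text \<open>In the factorization of \<open>a ^ n - b ^ n\<close> both factors are divisible by
  \<open>n\<close>: \<open>a - b\<close> by assumption, and the cofactor because it is congruent to
  \<open>n * b ^ (n - 1)\<close>.\<close>

lemma cong_power_square_modulus:
  fixes a b :: int and n :: nat
  assumes "[a = b] (mod int n)"
  shows "[a ^ n = b ^ n] (mod int (n\<^sup>2))"
proof -
  have "[(\<Sum>i<n. b ^ (n - Suc i) * a ^ i) = (\<Sum>i<n. b ^ (n - Suc i) * b ^ i)] (mod int n)"
    using assms by (intro cong_sum cong_mult cong_pow) auto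
  also have "(\<Sum>i<n. b ^ (n - Suc i) * b ^ i) = (\<Sum>i<n. b ^ (n - 1))"
    by (intro sum.cong refl) (simp flip: power_add)
  also have "[\<dots> = 0] (mod int n)"
    by (simp add: cong_0_iff)
  finally have "int n dvd (\<Sum>i<n. b ^ (n - Suc i) * a ^ i)"
    by (simp add: cong_0_iff)
  with assms have "int n * int n dvd (a - b) * (\<Sum>i<n. b ^ (n - Suc i) * a ^ i)"
    by (intro mult_dvd_mono) (simp_all add: cong_iff_dvd_diff)
  then show ?thesis
    by (simp add: power_diff_sumr2[symmetric] cong_iff_dvd_diff power2_eq_square)
qed

lemma cong_power_square_modulus_nat:
  fixes a b n :: nat
  assumes "[a = b] (mod n)"
  shows "[a ^ n = b ^ n] (mod n\<^sup>2)"
  using cong_power_square_modulus[of "int a" "int b" n] assms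
  by (simp flip: cong_int_iff)

lemma residue_primroot_square_not_dvd:
  fixes p g :: nat
  assumes "prime p" and "residue_primroot (p\<^sup>2) g"
  shows "\<not> p dvd g"
proof
  assume "p dvd g"
  moreover have "coprime p g"
    using assms(2) by (simp add: residue_primroot_def)
  ultimately show False
    using assms(1) by (auto simp: coprime_absorb_left)
qed

text \<open>Injectivity is lifted from \<open>p\<close> to the square: \<open>p\<close>-th powers of
  congruent numbers agree modulo \<open>p\<^sup>2\<close>, where \<open>g\<close> has order
  \<open>p * (p - 1)\<close>, and cancelling \<open>p\<close> leaves exponents modulo
  \<open>p - 1\<close>. Counting then gives surjectivity.\<close>

lemma bij_betw_primroot_square_powers:
  fixes p g :: nat
  assumes "prime p" and "residue_primroot (p\<^sup>2) g"
  shows "bij_betw (\<lambda>j. g ^ (j + 1) mod p) {0..p - 2} {1..<p}"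
proof -
  have g: "coprime (p\<^sup>2) g" "ord (p\<^sup>2) g = p * (p - 1)"
    using assms totient_prime_power[of p 2] by (auto simp: residue_primroot_def)
  have p: "p \<ge> 2"
    using assms(1) by (rule prime_ge_2_nat)
  have "inj_on (\<lambda>j. g ^ (j + 1) mod p) {0..p - 2}"
  proof (rule inj_onI)
    fix i j
    assume ij: "i \<in> {0..p - 2}" "j \<in> {0..p - 2}" and eq: "g ^ (i + 1) mod p = g ^ (j + 1) mod p"
    have "[(g ^ (i + 1)) ^ p = (g ^ (j + 1)) ^ p] (mod p\<^sup>2)"
      using eq by (intro cong_power_square_modulus_nat) (simp add: cong_def)
    then have "[g ^ (p * (i + 1)) = g ^ (p * (j + 1))] (mod p\<^sup>2)"
      by (simp only: power_mult[symmetric] mult.commute)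
    then have "[p * (i + 1) = p * (j + 1)] (mod p * (p - 1))"
      using g by (simp only: order_divides_expdiff)
    then have "[i + 1 = j + 1] (mod p - 1)"
      using p by (simp add: cong_def mult_mod_right[symmetric] del: mult_Suc_right)
    then have "[i = j] (mod p - 1)"
      by (simp only: cong_add_rcancel_nat)
    with ij p show "i = j"
      by (intro cong_less_imp_eq_nat[of _ "p - 1"]) auto
  qed
  moreover have "(\<lambda>j. g ^ (j + 1) mod p) ` {0..p - 2} \<subseteq> {1..<p}"
  proof -
    have "\<not> p dvd g ^ (j + 1)" for j
      using residue_primroot_square_not_dvd[OF assms] assms(1) prime_dvd_power_nat by blast
    then show ?thesis
      using p by (auto simp: dvd_eq_mod_eq_0 Suc_le_eq simp del: power_Suc)
  qed
  moreover have "card {0..p - 2} = card {1..<p}"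
    using p by simp
  ultimately show ?thesis
    by (simp add: bij_betw_def card_image card_subset_eq)
qed

section \<open>The periods \<open>eta\<close> as Fourier coefficients\<close>

text \<open>With \<open>b = g ^ (j + 1) mod p\<close>, the first part of the exponent is a
  \<open>p\<close>-th power that depends only on \<open>b\<close> modulo \<open>p\<^sup>2\<close>.
  The second part is a multiple of \<open>p\<close>, so it yields a character modulo
  \<open>p\<close>.\<close>

lemma eta_fourier:
  fixes p g k :: nat and h :: int
  assumes p: "prime p" and g: "residue_primroot (p\<^sup>2) g" and h: "[int g * h = 1] (mod int p)"
  shows "eta p g k =
    (\<Sum>b = 1..<p. unity_root (p\<^sup>2) (int b ^ p) * unity_root p (h * int k * int b))"
proof -
  have p0: "p > 0"
    using p by (rule prime_gt_0_nat)
  have "eta p g k = (\<Sum>j = 0..p - 2. unity_root (p\<^sup>2) (int (g ^ (p * j) * (g ^ p + p * k))))"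
    by (simp only: eta_def unity_root_exp)
  also have "\<dots> = (\<Sum>j = 0..p - 2. unity_root (p\<^sup>2) (int (g ^ (j + 1) mod p) ^ p) *
      unity_root p (h * int k * int (g ^ (j + 1) mod p)))"
  proof (intro sum.cong refl)
    fix j
    have "int (g ^ (p * j) * (g ^ p + p * k)) =
        (int g ^ (j + 1)) ^ p + int p * ((int g ^ j) ^ p * int k)"
      by (simp add: algebra_simps flip: power_mult power_add)
    then have "unity_root (p\<^sup>2) (int (g ^ (p * j) * (g ^ p + p * k))) =
        unity_root (p\<^sup>2) ((int g ^ (j + 1)) ^ p) * unity_root p ((int g ^ j) ^ p * int k)"
      by (simp only: unity_root_add unity_root_square_mult[OF p0])
    also have "unity_root (p\<^sup>2) ((int g ^ (j + 1)) ^ p) =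
        unity_root (p\<^sup>2) (int (g ^ (j + 1) mod p) ^ p)"
      using p0 by (intro unity_root_cong cong_power_square_modulus) (auto simp: zmod_int cong_def)
    also have "unity_root p ((int g ^ j) ^ p * int k) =
        unity_root p (h * int k * int (g ^ (j + 1) mod p))"
    proof (rule unity_root_cong[OF p0])
      have "\<not> p dvd g ^ j"
        using residue_primroot_square_not_dvd[OF p g] p prime_dvd_power_nat by blast
      \<comment> \<open>Fermat reduces the \<open>p\<close>-th power to \<open>g ^ j\<close>;
        inserting \<open>int g * h\<close> then raises the exponent to \<open>j + 1\<close> at the
        cost of the factor \<open>h\<close>.\<close>
      then have "[g ^ j * (g ^ j) ^ (p - 1) = g ^ j * 1] (mod p)"
        by (intro cong_mult cong_refl fermat_theorem p)
      then have "[(g ^ j) ^ p = g ^ j] (mod p)"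
        using p0 by (simp add: power_eq_if[of _ p])
      then have "[(int g ^ j) ^ p * int k = 1 * int g ^ j * int k] (mod int p)"
        by (intro cong_mult) (simp_all flip: cong_int_iff)
      also have "[1 * int g ^ j * int k = int g * h * int g ^ j * int k] (mod int p)"
        using h by (intro cong_mult) (simp_all add: cong_sym)
      also have "int g * h * int g ^ j * int k = h * int k * int g ^ (j + 1)"
        by simp
      also have "[\<dots> = h * int k * int (g ^ (j + 1) mod p)] (mod int p)"
        by (intro cong_mult) (auto simp: cong_def zmod_int)
      finally show "[(int g ^ j) ^ p * int k = h * int k * int (g ^ (j + 1) mod p)] (mod int p)" .
    qed
    finally show "unity_root (p\<^sup>2) (int (g ^ (p * j) * (g ^ p + p * k))) =
        unity_root (p\<^sup>2) (int (g ^ (j + 1) mod p) ^ p) *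
        unity_root p (h * int k * int (g ^ (j + 1) mod p))" .
  qed
  also have "\<dots> =
      (\<Sum>b = 1..<p. unity_root (p\<^sup>2) (int b ^ p) * unity_root p (h * int k * int b))"
    by (rule sum.reindex_bij_betw[OF bij_betw_primroot_square_powers[OF p g]])
  finally show ?thesis .
qed

theorem theorem5:
  fixes p g :: nat and x :: complex
  assumes "prime p" and "p \<ge> 5" and "residue_primroot (p\<^sup>2) g"
  shows "det (A p x) = (-1) ^ ((p + 1) div 2) * L p g x"
proof -
  have p0: "p > 0" and "odd p"
    using assms(1,2) prime_odd_nat[of p] by auto
  have "coprime (int g) (int p)"
    using assms(3) by (simp add: residue_primroot_def coprime_commute)
  then obtain h where h: "[int g * h = 1] (mod int p)"
    using cong_solve_coprime_int by blast
  then have cop: "coprime h (int p)"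
    by (metis coprime_iff_invertible_int mult.commute)
  \<comment> \<open>One function on residues covers both cases of \<open>entry\<close>; its value at
    0 later splits off as the summand \<open>- x\<close>.\<close>
  define F where "F = (\<lambda>t. if int p dvd t then - x else unity_root (p\<^sup>2) (t ^ p))"
  have F: "F s = F t" if "[s = t] (mod int p)" for s t
    using that p0 unity_root_cong[OF _ cong_power_square_modulus[OF that]]
    by (simp add: F_def cong_dvd_iff)
  have "entry p x m n = F (int m + int n)" for m n
    unfolding F_def entry_def unity_root_exp[symmetric] cong_0_iff
    by (simp flip: of_nat_add)
  then have "det (A p x) = (- 1) ^ ((p - 1) div 2) *
      (\<Prod>k = 1..p. \<Sum>b<p. F (int b) * unity_root p (h * int k * int b))"
    using det_hankel_periodic[OF \<open>odd p\<close> cop F] by (simp add: A_def)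
  also have "(\<Prod>k = 1..p. \<Sum>b<p. F (int b) * unity_root p (h * int k * int b)) =
      (\<Prod>k = 1..p. - (x - eta p g k))"
  proof (intro prod.cong refl)
    fix k
    have "(\<Sum>b<p. F (int b) * unity_root p (h * int k * int b)) =
        - x + (\<Sum>b = 1..<p. F (int b) * unity_root p (h * int k * int b))"
      using p0 by (simp add: F_def lessThan_atLeast0 sum.atLeast_Suc_lessThan)
    also have "(\<Sum>b = 1..<p. F (int b) * unity_root p (h * int k * int b)) = eta p g k"
      unfolding eta_fourier[OF assms(1,3) h]
      by (intro sum.cong refl) (auto simp: F_def dest: nat_dvd_not_less)
    finally show "(\<Sum>b<p. F (int b) * unity_root p (h * int k * int b)) = - (x - eta p g k)"
      by simp
  qed
  \<comment> \<open>An odd number \<open>p\<close> of factors changes sign; this sign turns the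
    exponent \<open>(p - 1) div 2\<close> into \<open>(p + 1) div 2\<close>.\<close>
  also have "\<dots> = - L p g x"
    using \<open>odd p\<close> by (simp add: L_def prod_uminus del: minus_diff_eq)
  also have "(- 1) ^ ((p - 1) div 2) * - L p g x = (-1) ^ ((p + 1) div 2) * L p g x"
    using \<open>odd p\<close> by (auto elim!: oddE)
  finally show ?thesis .
qed

end
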